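(* Let $B = (B, \circ, \cdot)$ be a skew left brace, and let $R : B \times B \to B \times B$ be defined by $R(a,b) = (\sigma_a(b), \tau_b(a))$ for $a, b \in B$, where $\sigma_a(b) = a^{-1} \cdot (a \circ b)$ and $\tau_b(a) = \overline{\sigma_a(b)} \circ a \circ b$. Then $R$ is a solution of the Yang-Baxter equation: for all $a, b, c \in B$, \[ (R \times \mathrm{id})(\mathrm{id} \times R)(R \times \mathrm{id})(a,b,c) = (\mathrm{id} \times R)(R \times \mathrm{id})(\mathrm{id} \times R)(a,b,c). \]
   Context: A skew left brace is a set $B$ with two group operations $\circ$ and $\cdot$ (neither assumed commutative) satisfying the single compatibility condition \[ x \circ (y \cdot z) = (x \circ y) \cdot x^{-1} \cdot (x \circ z) \quad \text{for all } x, y, z \in B. \] Here $x^{-1}$ denotes the inverse of $x$ in the group $(B, \cdot)$ and $\overline{x}$ denotes the inverse of $x$ in the group $(B, \circ)$. The maps $R \times \mathrm{id}$ and $\mathrm{id} \times R$ are maps $B \times B \times B \to B \times B \times B$, acting by $R$ on the first two coordinates (respectively the last two coordinates) and as the identity on the remaining coordinate; juxtaposition denotes composition of maps, with the rightmost map applied first. *)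

theory Defs
  imports "HOL-Algebra.Group"
begin

text \<open>
  A skew left brace is represented by two groups \<open>C\<close> (the operation \<open>\<circ>\<close>) and \<open>M\<close>
  (the operation \<open>\<cdot>\<close>) on one carrier. Neither is assumed commutative.
\<close>

locale skew_left_brace = circ: group C + dot: group M
  for C :: "('a, 'c) monoid_scheme" and M :: "('a, 'd) monoid_scheme" +
  assumes same_carrier: "carrier C = carrier M"
    and compat: "\<lbrakk>x \<in> carrier M; y \<in> carrier M; z \<in> carrier M\<rbrakk> \<Longrightarrow>
      x \<otimes>\<^bsub>C\<^esub> (y \<otimes>\<^bsub>M\<^esub> z) = (x \<otimes>\<^bsub>C\<^esub> y) \<otimes>\<^bsub>M\<^esub> inv\<^bsub>M\<^esub> x \<otimes>\<^bsub>M\<^esub> (x \<otimes>\<^bsub>C\<^esub> z)"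

definition brace_sigma ::
    "('a, 'c) monoid_scheme \<Rightarrow> ('a, 'd) monoid_scheme \<Rightarrow> 'a \<Rightarrow> 'a \<Rightarrow> 'a" where
  "brace_sigma C M a b = inv\<^bsub>M\<^esub> a \<otimes>\<^bsub>M\<^esub> (a \<otimes>\<^bsub>C\<^esub> b)"

text \<open>As in \<open>\<tau>\<^sub>b(a)\<close>, the subscript comes first: \<open>brace_tau C M b a\<close>.\<close>

definition brace_tau ::
    "('a, 'c) monoid_scheme \<Rightarrow> ('a, 'd) monoid_scheme \<Rightarrow> 'a \<Rightarrow> 'a \<Rightarrow> 'a" where
  "brace_tau C M b a = inv\<^bsub>C\<^esub> (brace_sigma C M a b) \<otimes>\<^bsub>C\<^esub> a \<otimes>\<^bsub>C\<^esub> b"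

definition brace_R ::
    "('a, 'c) monoid_scheme \<Rightarrow> ('a, 'd) monoid_scheme \<Rightarrow> 'a \<times> 'a \<Rightarrow> 'a \<times> 'a" where
  "brace_R C M = (\<lambda>(a, b). (brace_sigma C M a b, brace_tau C M b a))"

text \<open>
  Triples are nested to the right, so \<open>id \<times> R\<close> is \<^term>\<open>map_prod id R\<close>, whereas
  \<open>R \<times> id\<close> has to regroup the coordinates.
\<close>

definition R_times_id :: "('a \<times> 'a \<Rightarrow> 'a \<times> 'a) \<Rightarrow> 'a \<times> 'a \<times> 'a \<Rightarrow> 'a \<times> 'a \<times> 'a" where
  "R_times_id R = (\<lambda>(a, b, c). (fst (R (a, b)), snd (R (a, b)), c))"

definition id_times_R :: "('a \<times> 'a \<Rightarrow> 'a \<times> 'a) \<Rightarrow> 'a \<times> 'a \<times> 'a \<Rightarrow> 'a \<times> 'a \<times> 'a" where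
  "id_times_R R = map_prod id R"

text \<open>A solution on \<open>B\<close> is in particular a map from \<open>B \<times> B\<close> to itself.\<close>

definition yang_baxter_solution :: "'a set \<Rightarrow> ('a \<times> 'a \<Rightarrow> 'a \<times> 'a) \<Rightarrow> bool" where
  "yang_baxter_solution B R \<longleftrightarrow>
     R \<in> B \<times> B \<rightarrow> B \<times> B \<and>
     (\<forall>a\<in>B. \<forall>b\<in>B. \<forall>c\<in>B.
        (R_times_id R \<circ> id_times_R R \<circ> R_times_id R) (a, b, c) =
        (id_times_R R \<circ> R_times_id R \<circ> id_times_R R) (a, b, c))"

end

theory Submission
  imports Defs
begin

text \<open>
  Write \<open>\<sigma>\<close> and \<open>\<tau>\<close> for the two components of \<open>R\<close>. The compatibility condition says that
  each \<open>\<sigma>\<^sub>a\<close> is an endomorphism of the group with operation \<open>\<cdot>\<close> (\<open>sigma_dot\<close>), and it follows that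
  \<open>\<sigma>\<close> is a left action of the group with operation \<open>\<circ>\<close> (\<open>sigma_action\<close>). The map \<open>\<tau>\<close> is chosen so
  that \<open>R\<close> preserves \<open>\<circ>\<close>-products: \<open>\<sigma>\<^sub>a(b) \<circ> \<tau>\<^sub>b(a) = a \<circ> b\<close> (\<open>sigma_circ_tau\<close>). The two
  properties of \<open>\<sigma>\<close> give a rule for \<open>\<sigma>\<^sub>a(b \<circ> c)\<close> (\<open>sigma_circ\<close>), which says precisely that
  \<open>\<tau>\<close> is a right action (\<open>tau_action\<close>).

  The Yang-Baxter equation is then the comparison of two triples. Their first entries are
  \<open>\<sigma>\<^sub>x(\<sigma>\<^sub>y(c))\<close> with \<open>x = \<sigma>\<^sub>a(b)\<close>, \<open>y = \<tau>\<^sub>b(a)\<close> on the left, and \<open>\<sigma>\<^sub>a(\<sigma>\<^sub>b(c))\<close> on the right;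
  as \<open>x \<circ> y = a \<circ> b\<close>, they agree because \<open>\<sigma>\<close> is an action. The last entries agree for the mirrored
  reason, because \<open>\<tau>\<close> is an action. Finally, both sides have the same \<open>\<circ>\<close>-product
  \<open>a \<circ> b \<circ> c\<close>, since \<open>R\<close> preserves products, so the middle entries agree by cancellation.
\<close>

context skew_left_brace
begin

abbreviation sigma :: "'a \<Rightarrow> 'a \<Rightarrow> 'a" where
  "sigma \<equiv> brace_sigma C M"

abbreviation tau :: "'a \<Rightarrow> 'a \<Rightarrow> 'a" where
  "tau \<equiv> brace_tau C M"

lemma circ_closed [simp, intro]:
  "\<lbrakk>a \<in> carrier M; b \<in> carrier M\<rbrakk> \<Longrightarrow> a \<otimes>\<^bsub>C\<^esub> b \<in> carrier M"
  using circ.m_closed same_carrier by simp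

lemma circ_inv_closed [simp, intro]: "a \<in> carrier M \<Longrightarrow> inv\<^bsub>C\<^esub> a \<in> carrier M"
  using circ.inv_closed same_carrier by simp

lemma circ_assoc:
  "\<lbrakk>a \<in> carrier M; b \<in> carrier M; c \<in> carrier M\<rbrakk> \<Longrightarrow>
    a \<otimes>\<^bsub>C\<^esub> b \<otimes>\<^bsub>C\<^esub> c = a \<otimes>\<^bsub>C\<^esub> (b \<otimes>\<^bsub>C\<^esub> c)"
  using circ.m_assoc same_carrier by simp

lemma sigma_closed [simp, intro]:
  "\<lbrakk>a \<in> carrier M; b \<in> carrier M\<rbrakk> \<Longrightarrow> sigma a b \<in> carrier M"
  by (simp add: brace_sigma_def)

lemma tau_closed [simp, intro]:
  "\<lbrakk>a \<in> carrier M; b \<in> carrier M\<rbrakk> \<Longrightarrow> tau b a \<in> carrier M"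
  by (simp add: brace_tau_def)

lemma dot_sigma:
  "\<lbrakk>a \<in> carrier M; b \<in> carrier M\<rbrakk> \<Longrightarrow> a \<otimes>\<^bsub>M\<^esub> sigma a b = a \<otimes>\<^bsub>C\<^esub> b"
  by (simp add: brace_sigma_def dot.m_assoc [symmetric])

lemma sigma_dot:
  "\<lbrakk>a \<in> carrier M; b \<in> carrier M; c \<in> carrier M\<rbrakk> \<Longrightarrow>
    sigma a (b \<otimes>\<^bsub>M\<^esub> c) = sigma a b \<otimes>\<^bsub>M\<^esub> sigma a c"
  by (simp add: brace_sigma_def compat dot.m_assoc)

text \<open>
  Multiplying either side by \<open>a \<cdot> \<sigma>\<^sub>a(b) = a \<circ> b\<close> on the left gives the product \<open>a \<circ> b \<circ> c\<close>.
\<close>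

lemma sigma_action:
  assumes "a \<in> carrier M" "b \<in> carrier M" "c \<in> carrier M"
  shows "sigma (a \<otimes>\<^bsub>C\<^esub> b) c = sigma a (sigma b c)"
proof -
  have "(a \<otimes>\<^bsub>C\<^esub> b) \<otimes>\<^bsub>M\<^esub> sigma a (sigma b c) = a \<otimes>\<^bsub>M\<^esub> (sigma a b \<otimes>\<^bsub>M\<^esub> sigma a (sigma b c))"
    using assms by (simp add: dot_sigma [symmetric] dot.m_assoc)
  also have "\<dots> = a \<otimes>\<^bsub>M\<^esub> sigma a (b \<otimes>\<^bsub>C\<^esub> c)"
    using assms by (simp add: sigma_dot [symmetric] dot_sigma)
  also have "\<dots> = (a \<otimes>\<^bsub>C\<^esub> b) \<otimes>\<^bsub>M\<^esub> sigma (a \<otimes>\<^bsub>C\<^esub> b) c"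
    using assms by (simp add: dot_sigma circ_assoc)
  finally show ?thesis
    using assms by simp
qed

lemma sigma_circ_tau:
  assumes "a \<in> carrier M" "b \<in> carrier M"
  shows "sigma a b \<otimes>\<^bsub>C\<^esub> tau b a = a \<otimes>\<^bsub>C\<^esub> b"
proof -
  have "sigma a b \<in> carrier C" "a \<in> carrier C" "b \<in> carrier C"
    using assms same_carrier by auto
  then show ?thesis
    by (simp add: brace_tau_def circ.m_assoc [symmetric])
qed

lemma sigma_sigma_tau:
  assumes "a \<in> carrier M" "b \<in> carrier M" "c \<in> carrier M"
  shows "sigma (sigma a b) (sigma (tau b a) c) = sigma a (sigma b c)"
  using assms by (simp add: sigma_action [symmetric] sigma_circ_tau)

text \<open>
  Turning \<open>b \<circ> c\<close> into \<open>b \<cdot> \<sigma>\<^sub>b(c)\<close> makes \<open>\<sigma>\<^sub>a\<close> distribute over it, and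
  \<open>\<sigma>\<^sub>a(\<sigma>\<^sub>b(c))\<close> can be rewritten so that the \<open>\<cdot>\<close>-product becomes a \<open>\<circ>\<close>-product again.
\<close>

lemma sigma_circ:
  assumes "a \<in> carrier M" "b \<in> carrier M" "c \<in> carrier M"
  shows "sigma a (b \<otimes>\<^bsub>C\<^esub> c) = sigma a b \<otimes>\<^bsub>C\<^esub> sigma (tau b a) c"
proof -
  have "sigma a (b \<otimes>\<^bsub>C\<^esub> c) = sigma a b \<otimes>\<^bsub>M\<^esub> sigma a (sigma b c)"
    using assms by (simp add: sigma_dot [symmetric] dot_sigma)
  also have "\<dots> = sigma a b \<otimes>\<^bsub>M\<^esub> sigma (sigma a b) (sigma (tau b a) c)"
    using assms by (simp add: sigma_sigma_tau)
  also have "\<dots> = sigma a b \<otimes>\<^bsub>C\<^esub> sigma (tau b a) c"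
    using assms by (simp add: dot_sigma)
  finally show ?thesis .
qed

text \<open>
  Both sides complete \<open>\<sigma>\<^sub>a(b \<circ> c)\<close> to the product \<open>a \<circ> b \<circ> c\<close>.
\<close>

lemma tau_action:
  assumes "a \<in> carrier M" "b \<in> carrier M" "c \<in> carrier M"
  shows "tau (b \<otimes>\<^bsub>C\<^esub> c) a = tau c (tau b a)"
proof -
  have "sigma a (b \<otimes>\<^bsub>C\<^esub> c) \<otimes>\<^bsub>C\<^esub> tau c (tau b a)
      = sigma a b \<otimes>\<^bsub>C\<^esub> (sigma (tau b a) c \<otimes>\<^bsub>C\<^esub> tau c (tau b a))"
    using assms by (simp add: sigma_circ circ_assoc)
  also have "\<dots> = sigma a b \<otimes>\<^bsub>C\<^esub> tau b a \<otimes>\<^bsub>C\<^esub> c"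
    using assms by (simp add: circ_assoc sigma_circ_tau [of "tau b a" c])
  also have "\<dots> = sigma a (b \<otimes>\<^bsub>C\<^esub> c) \<otimes>\<^bsub>C\<^esub> tau (b \<otimes>\<^bsub>C\<^esub> c) a"
    using assms by (simp add: circ_assoc [symmetric] sigma_circ_tau)
  finally show ?thesis
    using assms same_carrier by simp
qed

lemma tau_tau_sigma:
  assumes "a \<in> carrier M" "b \<in> carrier M" "c \<in> carrier M"
  shows "tau (tau c b) (tau (sigma b c) a) = tau c (tau b a)"
  using assms by (simp add: tau_action [symmetric] sigma_circ_tau)

text \<open>
  These are the middle entries of the two triples. Each is determined by its neighbours, because
  the \<open>\<circ>\<close>-product of each triple is \<open>a \<circ> b \<circ> c\<close>.
\<close>

lemma tau_sigma_middle:
  assumes "a \<in> carrier M" "b \<in> carrier M" "c \<in> carrier M"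
  shows "tau (sigma (tau b a) c) (sigma a b) = sigma (tau (sigma b c) a) (tau c b)"
    (is "?m = ?n")
proof -
  let ?s = "sigma a (sigma b c)" and ?t = "tau c (tau b a)"
  have "?s \<otimes>\<^bsub>C\<^esub> ?m = sigma a b \<otimes>\<^bsub>C\<^esub> sigma (tau b a) c"
    using assms sigma_circ_tau [of "sigma a b" "sigma (tau b a) c"]
    by (simp add: sigma_sigma_tau)
  then have "?s \<otimes>\<^bsub>C\<^esub> ?m \<otimes>\<^bsub>C\<^esub> ?t = sigma a b \<otimes>\<^bsub>C\<^esub> tau b a \<otimes>\<^bsub>C\<^esub> c"
    using assms by (simp add: circ_assoc sigma_circ_tau [of "tau b a" c])
  also have "\<dots> = a \<otimes>\<^bsub>C\<^esub> (sigma b c \<otimes>\<^bsub>C\<^esub> tau c b)"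
    using assms by (simp add: sigma_circ_tau) (simp add: circ_assoc)
  also have "\<dots> = ?s \<otimes>\<^bsub>C\<^esub> tau (sigma b c) a \<otimes>\<^bsub>C\<^esub> tau c b"
    using assms by (simp add: circ_assoc [symmetric] sigma_circ_tau [of a "sigma b c"])
  also have "\<dots> = ?s \<otimes>\<^bsub>C\<^esub> ?n \<otimes>\<^bsub>C\<^esub> ?t"
    using assms sigma_circ_tau [of "tau (sigma b c) a" "tau c b"]
    by (simp add: circ_assoc tau_tau_sigma)
  finally show ?thesis
    using assms same_carrier by simp
qed

end

theorem theorem1:
  fixes C :: "('a, 'c) monoid_scheme" and M :: "('a, 'd) monoid_scheme"
  assumes "skew_left_brace C M"
  shows "yang_baxter_solution (carrier M) (brace_R C M)"
proof -
  interpret skew_left_brace C M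
    by (fact assms)
  show ?thesis
    unfolding yang_baxter_solution_def
    by (auto simp: brace_R_def R_times_id_def id_times_R_def
        sigma_sigma_tau tau_tau_sigma tau_sigma_middle)
qed

end
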